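(* Let $m\geq 2$ and $h\geq 0$ be integers and let $T_{h,m}$ be the perfect $m$-ary tree of height $h$. Then the number $\mathcal{L}(T_{h,m})$ of random walk labelings of $T_{h,m}$ is $$\mathcal{L}(T_{h,m})=\sum_{k=0}^{h}m^{k}\,\gamma_{h,m,k}\left(\prod_{j=1}^{h-k}\alpha_{j,m}^{m^{h-k-j}}\right)\prod_{j=0}^{k-1}\left(\beta_{h,m,j}\prod_{\ell=1}^{h-1-j}\alpha_{\ell,m}^{(m-1)m^{h-1-j-\ell}}\right),$$ where $$\alpha_{j,m}=\binom{\frac{m^{j+1}-m}{m-1}}{\underbrace{\tfrac{m^{j}-1}{m-1},\ldots,\tfrac{m^{j}-1}{m-1}}_{m\text{ times}}},\qquad \beta_{h,m,k}=\binom{\frac{m^{h+1}-m^{h-k}}{m-1}-1}{\underbrace{\tfrac{m^{h-k}-1}{m-1},\ldots,\tfrac{m^{h-k}-1}{m-1}}_{m-1\text{ times}},\ \tfrac{m^{h+1}-m^{h-k+1}}{m-1}},\qquad \gamma_{h,m,k}=\binom{\frac{m^{h+1}-m}{m-1}}{\frac{m^{h+1-k}-m}{m-1}}.$$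
   Context: Let $G$ be a finite connected undirected graph with vertex set $V$. A random walk labeling of $G$ is a labeling of $V$ obtainable by the following process: (1) set $i=1$, choose $v\in V$, and label $v$ with $i$; (2) as long as there are unlabeled vertices, pick $w\in V$ adjacent to $v$ and replace $v$ with $w$; if (the new) $v$ is not labeled, increase $i$ by $1$ and label $v$ with $i$. (Thus vertices are labeled $1,\ldots,|V|$ in the order of their first visit by a walk on $G$.) The number of distinct random walk labelings of $G$ is denoted $\mathcal{L}(G)$. The perfect $m$-ary tree $T_{h,m}$ of height $h$ is the rooted tree in which every vertex of depth less than $h$ has exactly $m$ children and every vertex of depth $h$ is a leaf; the vertices of the tree are regarded as distinguishable. The symbol $\binom{N}{n_1,\ldots,n_r}$ with $N=n_1+\cdots+n_r$ denotes the multinomial coefficient $\frac{N!}{n_1!\cdots n_r!}$; the symbol defining $\gamma_{h,m,k}$ is an ordinary binomial coefficient. Empty products equal $1$. *)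

theory Defs
  imports "Graph_Theory.Graph_Theory"
begin

section \<open>Random walk labelings\<close>

text \<open>
  Undirected graphs are symmetric digraphs, as in the locale \<^locale>\<open>pair_graph\<close>.
  A state \<open>rw_state G v i L\<close> consists of the current vertex \<open>v\<close>, the counter \<open>i\<close> and the partial
  labeling \<open>L\<close> built so far (\<open>None\<close> means unlabeled).
\<close>

inductive rw_state ::
  "'a pair_pre_digraph \<Rightarrow> 'a \<Rightarrow> nat \<Rightarrow> ('a \<Rightarrow> nat option) \<Rightarrow> bool" for G where
  start: "v \<in> pverts G \<Longrightarrow> rw_state G v 1 [v \<mapsto> 1]"
| step_labeled:
    "rw_state G v i L \<Longrightarrow> \<exists>u \<in> pverts G. L u = None \<Longrightarrow> (v, w) \<in> parcs G \<Longrightarrow> L w \<noteq> None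
      \<Longrightarrow> rw_state G w i L"
| step_unlabeled:
    "rw_state G v i L \<Longrightarrow> \<exists>u \<in> pverts G. L u = None \<Longrightarrow> (v, w) \<in> parcs G \<Longrightarrow> L w = None
      \<Longrightarrow> rw_state G w (i + 1) (L(w \<mapsto> i + 1))"

definition random_walk_labelings :: "'a pair_pre_digraph \<Rightarrow> ('a \<Rightarrow> nat option) set" where
  "random_walk_labelings G =
     {L. (\<exists>v i. rw_state G v i L) \<and> (\<forall>u \<in> pverts G. L u \<noteq> None)}"

definition num_random_walk_labelings :: "'a pair_pre_digraph \<Rightarrow> nat" where
  "num_random_walk_labelings G = card (random_walk_labelings G)"

text \<open>The cardinality is that of a finite set whenever the graph is finite.\<close>

lemma rw_state_invariant:
  assumes "pair_wf_digraph G" and "finite (pverts G)" and "rw_state G v i L"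
  shows "v \<in> pverts G \<and> dom L \<subseteq> pverts G \<and> i = card (dom L) \<and> ran L \<subseteq> {..i}"
  using assms(3)
proof (induction rule: rw_state.induct)
  case (step_unlabeled v i L w)
  then have w: "w \<in> pverts G" "w \<notin> dom L"
    using pair_wf_digraph.in_arcsD2[OF assms(1)] by auto
  moreover have "finite (dom L)"
    using step_unlabeled.IH assms(2) finite_subset by blast
  moreover have "ran (L(w \<mapsto> i + 1)) \<subseteq> {..i + 1}"
    using step_unlabeled.IH step_unlabeled.hyps by auto
  ultimately show ?case
    using step_unlabeled.IH by (simp del: fun_upd_apply)
qed (use pair_wf_digraph.in_arcsD2[OF assms(1)] in \<open>auto simp del: fun_upd_apply\<close>)

lemma finite_random_walk_labelings:
  assumes "pair_wf_digraph G" and "finite (pverts G)"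
  shows "finite (random_walk_labelings G)"
proof (rule finite_subset)
  show "random_walk_labelings G \<subseteq> {L. dom L = pverts G \<and> ran L \<subseteq> {..card (pverts G)}}"
  proof
    fix L assume "L \<in> random_walk_labelings G"
    then obtain v i where "rw_state G v i L" and all: "\<forall>u \<in> pverts G. L u \<noteq> None"
      by (auto simp: random_walk_labelings_def)
    with rw_state_invariant[OF assms] have "dom L \<subseteq> pverts G" "i = card (dom L)" "ran L \<subseteq> {..i}"
      by blast+
    moreover have "pverts G \<subseteq> dom L"
      using all by auto
    ultimately show "L \<in> {L. dom L = pverts G \<and> ran L \<subseteq> {..card (pverts G)}}"
      by auto
  qed
  show "finite {L. dom L = pverts G \<and> ran L \<subseteq> {..card (pverts G)}}"
    using assms(2) by (intro finite_set_of_finite_maps) auto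
qed


section \<open>Perfect trees\<close>

text \<open>
  A vertex is the list of child indices leading from it up to the root \<open>[]\<close>; the children of \<open>p\<close>
  are \<open>c # p\<close> for \<open>c < m\<close>, and the depth of \<open>p\<close> is \<open>length p\<close>.
\<close>

definition perfect_tree :: "nat \<Rightarrow> nat \<Rightarrow> nat list pair_pre_digraph" where
  "perfect_tree h m =
     (let V = {p. length p \<le> h \<and> set p \<subseteq> {..<m}}
      in \<lparr> pverts = V,
           parcs = {(p, q). p \<in> V \<and> q \<in> V \<and> (\<exists>c. q = c # p \<or> p = c # q)} \<rparr>)"

lemma pair_graph_perfect_tree: "pair_graph (perfect_tree h m)"
proof -
  let ?T = "perfect_tree h m"
  have "finite {p. set p \<subseteq> {..<m} \<and> length p \<le> h}"
    by (rule finite_lists_length_le) simp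
  then have fin: "finite (pverts ?T)"
    by (simp add: perfect_tree_def Let_def conj_commute)
  have arcs: "parcs ?T \<subseteq> pverts ?T \<times> pverts ?T"
    by (auto simp: perfect_tree_def Let_def)
  have "finite (parcs ?T)"
    using arcs fin by (meson finite_SigmaI finite_subset)
  moreover have "sym (parcs ?T)"
    by (auto simp: perfect_tree_def Let_def sym_def)
  moreover have "fst e \<noteq> snd e" if "e \<in> parcs ?T" for e
    using that by (auto simp: perfect_tree_def Let_def)
  ultimately show ?thesis
    using arcs fin by unfold_locales (auto simp: symmetric_def)
qed

lemma connected_perfect_tree: "connected (perfect_tree h m)"
proof -
  let ?T = "perfect_tree h m"
  interpret pair_graph ?T by (rule pair_graph_perfect_tree)
  have root: "p \<rightarrow>\<^sup>*\<^bsub>?T\<^esub> []" if "p \<in> pverts ?T" for p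
    using that
  proof (induction p)
    case Nil
    then show ?case by (simp add: reachable_refl)
  next
    case (Cons c p)
    then have "p \<in> pverts ?T" "(c # p, p) \<in> parcs ?T"
      by (auto simp: perfect_tree_def Let_def)
    with Cons.IH show ?case
      by (auto intro: adj_reachable_trans)
  qed
  have "p \<rightarrow>\<^sup>*\<^bsub>?T\<^esub> q" if "p \<in> pverts ?T" "q \<in> pverts ?T" for p q
    using root[OF that(1)] root[OF that(2)] symmetric_reachable[OF sym_arcs] reachable_trans by blast
  then have "p \<rightarrow>\<^sup>*\<^bsub>mk_symmetric ?T\<^esub> q" if "p \<in> pverts ?T" "q \<in> pverts ?T" for p q
    using that by (blast intro: reachable_mk_symmetricI)
  moreover have "[] \<in> pverts ?T"
    by (simp add: perfect_tree_def Let_def)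
  ultimately show ?thesis
    unfolding connected_def strongly_connected_def by (auto simp: mk_symmetric_def)
qed


section \<open>The coefficients\<close>

text \<open>
  The division is exact because \<open>multinomial N ns\<close> is only used with \<open>N = sum_list ns\<close>. Likewise,
  every quotient by \<open>m - 1\<close> below is exact, and no natural subtraction truncates, for \<open>m \<ge> 2\<close>
  and \<open>k \<le> h\<close>.
\<close>

definition multinomial :: "nat \<Rightarrow> nat list \<Rightarrow> nat" where
  "multinomial N ns = fact N div (\<Prod>n\<leftarrow>ns. fact n)"

definition rw_alpha :: "nat \<Rightarrow> nat \<Rightarrow> nat" where
  "rw_alpha j m =
     multinomial ((m^(j + 1) - m) div (m - 1)) (replicate m ((m^j - 1) div (m - 1)))"

definition rw_beta :: "nat \<Rightarrow> nat \<Rightarrow> nat \<Rightarrow> nat" where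
  "rw_beta h m k =
     multinomial ((m^(h + 1) - m^(h - k)) div (m - 1) - 1)
       (replicate (m - 1) ((m^(h - k) - 1) div (m - 1)) @ [(m^(h + 1) - m^(h - k + 1)) div (m - 1)])"

definition rw_gamma :: "nat \<Rightarrow> nat \<Rightarrow> nat \<Rightarrow> nat" where
  "rw_gamma h m k =
     ((m^(h + 1) - m) div (m - 1)) choose ((m^(h + 1 - k) - m) div (m - 1))"

end

theory Submission
  imports Defs "HOL-Library.Sublist"
begin

text \<open>
  A labeling is the same as an order of the vertices in which every vertex but the first is adjacent
  to an earlier one. Fix the first vertex, of depth \<open>k\<close>. If the unvisited vertices split into
  pieces without edges between them, such an order is an arbitrary shuffle of orders of the pieces, so
  multinomial coefficients appear. Below a visited vertex the pieces are the \<open>m\<close> child subtrees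
  (\<open>\<alpha>\<close>); after moving up to the ancestor at depth \<open>j\<close> they are the \<open>m - 1\<close> other child subtrees
  and everything outside its own subtree (\<open>\<beta>\<close>); at the first vertex itself, the vertices below it
  are shuffled with all the others (\<open>\<gamma>\<close>).
\<close>

section \<open>Orders in which a visited set can grow\<close>

text \<open>Only the visited set \<open>S\<close> is recorded, not the walker's position: in a
  symmetric graph the walker can return to any visited vertex through visited ones, so any neighbour
  of \<open>S\<close> can come next.\<close>

fun grows :: "('a \<times> 'a) set \<Rightarrow> 'a set \<Rightarrow> 'a list \<Rightarrow> bool" where
  "grows E S [] \<longleftrightarrow> True"
| "grows E S (x # xs) \<longleftrightarrow> (\<exists>u\<in>S. (u, x) \<in> E) \<and> grows E (insert x S) xs"

definition growth_orders :: "('a \<times> 'a) set \<Rightarrow> 'a set \<Rightarrow> 'a set \<Rightarrow> 'a list set" where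
  "growth_orders E S A = {xs. distinct xs \<and> set xs = A \<and> grows E S xs}"

lemma grows_append: "grows E S (xs @ ys) \<longleftrightarrow> grows E S xs \<and> grows E (S \<union> set xs) ys"
  by (induction xs arbitrary: S) auto

lemma grows_cong:
  assumes "\<And>x. x \<in> set xs \<Longrightarrow> (\<exists>u\<in>S. (u, x) \<in> E) \<longleftrightarrow> (\<exists>u\<in>T. (u, x) \<in> E)"
  shows "grows E S xs \<longleftrightarrow> grows E T xs"
  using assms
proof (induction xs arbitrary: S T)
  case (Cons a xs)
  have "grows E (insert a S) xs \<longleftrightarrow> grows E (insert a T) xs"
    by (rule Cons.IH) (use Cons.prems in auto)
  then show ?case using Cons.prems[of a] by simp
qed simp

lemma growth_orders_cong:
  assumes "\<And>x. x \<in> A \<Longrightarrow> (\<exists>u\<in>S. (u, x) \<in> E) \<longleftrightarrow> (\<exists>u\<in>T. (u, x) \<in> E)"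
  shows "growth_orders E S A = growth_orders E T A"
  using grows_cong[of _ S E T] assms by (auto simp: growth_orders_def)

lemma finite_growth_orders: "finite (growth_orders E S A)"
proof (cases "finite A")
  case True
  then have "finite {xs. set xs \<subseteq> A \<and> length xs = card A}"
    by (rule finite_lists_length_eq)
  then show ?thesis
    by (rule rev_finite_subset) (auto simp: growth_orders_def distinct_card)
next
  case False
  then have "growth_orders E S A = {}" by (auto simp: growth_orders_def)
  then show ?thesis by simp
qed

lemma growth_orders_empty [simp]: "growth_orders E S {} = {[]}"
  by (auto simp: growth_orders_def)

text \<open>Since \<open>(s, x)\<close> is the only arc from \<open>S\<close> into \<open>A\<close>,
  \<open>x\<close> has to come first; afterwards \<open>S\<close> gives no access to the remaining
  vertices and can be forgotten.\<close>

lemma card_growth_orders_unique_start: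
  assumes "x \<in> A" and "\<And>u y. u \<in> S \<Longrightarrow> y \<in> A \<Longrightarrow> (u, y) \<in> E \<longleftrightarrow> u = s \<and> y = x" and "s \<in> S"
  shows "card (growth_orders E S A) = card (growth_orders E {x} (A - {x}))"
proof -
  have "growth_orders E S A = (#) x ` growth_orders E (insert x S) (A - {x})" (is "?L = ?R")
  proof
    show "?L \<subseteq> ?R"
    proof
      fix zs assume "zs \<in> ?L"
      then have zs: "distinct zs" "set zs = A" "grows E S zs" by (auto simp: growth_orders_def)
      with \<open>x \<in> A\<close> obtain z ys where [simp]: "zs = z # ys" by (cases zs) auto
      from zs assms have "z = x" by auto
      with zs show "zs \<in> ?R" by (auto simp: growth_orders_def)
    qed
    show "?R \<subseteq> ?L" using assms by (auto simp: growth_orders_def)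
  qed
  also have "growth_orders E (insert x S) (A - {x}) = growth_orders E {x} (A - {x})"
    by (rule growth_orders_cong) (use assms in auto)
  finally show ?thesis by (simp add: card_image)
qed

section \<open>Shuffles of growth orders of separated sets\<close>

lemma grows_shuffles:
  assumes "zs \<in> shuffles xs ys" and "E \<inter> (set xs \<times> set ys \<union> set ys \<times> set xs) = {}"
  shows "grows E S zs \<longleftrightarrow> grows E S xs \<and> grows E S ys"
  using assms
proof (induction zs arbitrary: xs ys S)
  case (Cons z zs)
  from Cons.prems(1) consider xs' where "xs = z # xs'" "zs \<in> shuffles xs' ys"
    | ys' where "ys = z # ys'" "zs \<in> shuffles xs ys'"
    by (auto simp: Cons_in_shuffles_iff neq_Nil_conv)
  then show ?case
  proof cases
    case 1
    have "grows E (insert z S) zs \<longleftrightarrow> grows E (insert z S) xs' \<and> grows E (insert z S) ys"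
      using Cons.prems(2) by (intro Cons.IH 1) (auto simp: 1)
    \<comment> \<open>\<open>z\<close> comes from the other list and has no arc to an entry of
      \<open>ys\<close>, so visiting it opens nothing there.\<close>
    moreover have "grows E (insert z S) ys \<longleftrightarrow> grows E S ys"
      by (rule grows_cong) (use Cons.prems(2) 1 in auto)
    ultimately show ?thesis by (auto simp: 1)
  next
    case 2
    have "grows E (insert z S) zs \<longleftrightarrow> grows E (insert z S) xs \<and> grows E (insert z S) ys'"
      using Cons.prems(2) by (intro Cons.IH 2) (auto simp: 2)
    moreover have "grows E (insert z S) xs \<longleftrightarrow> grows E S xs"
      by (rule grows_cong) (use Cons.prems(2) 2 in auto)
    ultimately show ?thesis by (auto simp: 2)
  qed
qed simp

text \<open>Missing arcs make every interleaving admissible; disjointness lets the two pieces be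
  read off an interleaving.\<close>

definition separated :: "('a \<times> 'a) set \<Rightarrow> 'a set \<Rightarrow> 'a set \<Rightarrow> bool" where
  "separated E A B \<longleftrightarrow> A \<inter> B = {} \<and> E \<inter> (A \<times> B \<union> B \<times> A) = {}"

lemma separatedI:
  assumes "A \<inter> B = {}" and "\<And>u v. u \<in> A \<Longrightarrow> v \<in> B \<Longrightarrow> (u, v) \<notin> E \<and> (v, u) \<notin> E"
  shows "separated E A B"
  using assms unfolding separated_def by blast

lemma growth_orders_Un:
  assumes "separated E A B"
  shows "growth_orders E S (A \<union> B) =
    (\<Union>(xs, ys)\<in>growth_orders E S A \<times> growth_orders E S B. shuffles xs ys)" (is "?L = ?R")
proof
  show "?L \<subseteq> ?R"
  proof
    fix zs assume zs: "zs \<in> ?L"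
    let ?xs = "filter (\<lambda>z. z \<in> A) zs" and ?ys = "filter (\<lambda>z. z \<notin> A) zs"
    have sh: "zs \<in> shuffles ?xs ?ys" by (rule partition_in_shuffles)
    have sets: "set ?xs = A" "set ?ys = B"
      using zs assms by (auto simp: growth_orders_def separated_def)
    have "grows E S zs \<longleftrightarrow> grows E S ?xs \<and> grows E S ?ys"
      using assms unfolding separated_def
      by (intro grows_shuffles[OF sh]) (simp only: sets)
    with zs sets have "?xs \<in> growth_orders E S A" "?ys \<in> growth_orders E S B"
      by (auto simp: growth_orders_def)
    with sh show "zs \<in> ?R" by blast
  qed
  show "?R \<subseteq> ?L"
  proof
    fix zs assume "zs \<in> ?R"
    then obtain xs ys where xy: "xs \<in> growth_orders E S A" "ys \<in> growth_orders E S B"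
      and sh: "zs \<in> shuffles xs ys" by auto
    from xy have sets: "set xs = A" "set ys = B" by (auto simp: growth_orders_def)
    have "grows E S zs"
      using grows_shuffles[OF sh, of E S] xy assms by (auto simp: growth_orders_def separated_def)
    moreover have "distinct zs"
      using distinct_disjoint_shuffles[OF _ _ _ sh] xy assms
      by (auto simp: growth_orders_def separated_def)
    ultimately show "zs \<in> ?L"
      using set_shuffles[OF sh] sets by (auto simp: growth_orders_def)
  qed
qed

lemma card_growth_orders_Un:
  assumes "separated E A B"
  shows "card (growth_orders E S (A \<union> B)) =
    ((card A + card B) choose card A) * (card (growth_orders E S A) * card (growth_orders E S B))"
proof -
  let ?P = "growth_orders E S A \<times> growth_orders E S B"
  have shuf: "card (shuffles xs ys) = (card A + card B) choose card A"
    if "xs \<in> growth_orders E S A" "ys \<in> growth_orders E S B" for xs ys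
    using that assms
    by (subst card_disjoint_shuffles) (auto simp: growth_orders_def separated_def distinct_card)
  have disj: "shuffles xs ys \<inter> shuffles xs' ys' = {}"
    if "(xs, ys) \<in> ?P" "(xs', ys') \<in> ?P" "(xs, ys) \<noteq> (xs', ys')" for xs ys xs' ys'
  proof -
    \<comment> \<open>Filtering by membership in \<open>A\<close> recovers the pair from any of its
      shuffles, so different pairs have disjoint shuffle sets.\<close>
    have "filter (\<lambda>z. z \<in> A) zs = as \<and> filter (\<lambda>z. z \<notin> A) zs = bs"
      if "zs \<in> shuffles as bs" "(as, bs) \<in> ?P" for zs as bs
    proof -
      from that assms have s: "set as = A" "set as \<inter> set bs = {}"
        by (auto simp: growth_orders_def separated_def)
      show ?thesis
        using filter_shuffles_disjoint1[OF s(2) that(1)] by (simp add: s)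
    qed
    with that show ?thesis by blast
  qed
  have "card (growth_orders E S (A \<union> B)) = (\<Sum>p\<in>?P. card (case p of (xs, ys) \<Rightarrow> shuffles xs ys))"
    unfolding growth_orders_Un[OF assms]
    by (rule card_UN_disjoint) (use disj in \<open>auto simp: finite_growth_orders\<close>)
  also have "\<dots> = (\<Sum>p\<in>?P. (card A + card B) choose card A)"
    by (rule sum.cong) (auto simp: shuf)
  finally show ?thesis by (simp add: card_cartesian_product)
qed


section \<open>Multinomial coefficients\<close>

lemma prod_list_fact_dvd: "(\<Prod>n\<leftarrow>ns. fact n) dvd (fact (sum_list ns) :: nat)"
proof (induction ns)
  case (Cons a ns)
  then have "fact a * (\<Prod>n\<leftarrow>ns. fact n) dvd fact a * (fact (sum_list ns) :: nat)"
    by (rule mult_dvd_mono[OF dvd_refl])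
  also have "\<dots> dvd fact (a + sum_list ns)" by (rule fact_fact_dvd_fact)
  finally show ?case by simp
qed simp

lemma prod_list_fact_pos: "(\<Prod>n\<leftarrow>ns. fact n) > (0::nat)"
  by (induction ns) auto

text \<open>Splitting off one block: choose the positions of its \<open>a\<close> entries, then
  arrange the rest. This is the binomial factor of \<open>card_growth_orders_Un\<close>. The
  \<open>div\<close> in \<open>multinomial\<close> is exact by
  \<open>prod_list_fact_dvd\<close>.\<close>

lemma multinomial_Cons:
  "multinomial (sum_list (a # ns)) (a # ns) =
    ((a + sum_list ns) choose a) * multinomial (sum_list ns) ns"
proof -
  let ?P = "(\<Prod>n\<leftarrow>ns. fact n) :: nat"
  obtain q where q: "fact (sum_list ns) = ?P * q"
    using prod_list_fact_dvd by (rule dvdE)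
  have P: "?P > 0" by (rule prod_list_fact_pos)
  have "fact (a + sum_list ns) =
    fact a * fact (sum_list ns) * ((a + sum_list ns) choose a)"
    using binomial_fact_lemma[of a "a + sum_list ns"] by simp
  also have "\<dots> = (fact a * ?P) * (((a + sum_list ns) choose a) * q)"
    by (simp add: q)
  finally show ?thesis using P by (simp add: multinomial_def q)
qed

text \<open>Induction splits off the first piece with its binomial factor. The size of the union is
  proved alongside because that binomial refers to it.\<close>

lemma card_growth_orders_Union:
  assumes "sorted_wrt (separated E) As" and "\<And>A. A \<in> set As \<Longrightarrow> finite A"
  shows "card (growth_orders E S (\<Union> (set As))) =
      multinomial (sum_list (map card As)) (map card As)
        * (\<Prod>A\<leftarrow>As. card (growth_orders E S A))
    \<and> card (\<Union> (set As)) = sum_list (map card As)"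
  using assms
proof (induction As)
  case Nil
  show ?case by (simp add: multinomial_def)
next
  case (Cons A As)
  have sep: "separated E A (\<Union> (set As))"
    using Cons.prems by (auto simp: separated_def)
  then have "card (A \<union> \<Union> (set As)) = card A + card (\<Union> (set As))"
    using Cons.prems by (intro card_Un_disjoint) (auto simp: separated_def)
  with Cons show ?case
    using card_growth_orders_Un[OF sep, of S] multinomial_Cons[of "card A" "map card As"]
    by simp
qed


section \<open>Labelings as growth orders\<close>

text \<open>\<open>map_of\<close> takes the first match, so the reversal lets later entries override
  earlier ones; appending a vertex is then exactly the update made by a labeling step of the
  walk.\<close>

definition list_labeling :: "'a list \<Rightarrow> 'a \<Rightarrow> nat option" where
  "list_labeling xs = map_of (rev (zip xs [1..<Suc (length xs)]))"

lemma list_labeling_snoc: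
  "list_labeling (xs @ [x]) = (list_labeling xs)(x \<mapsto> length xs + 1)"
proof -
  have "[1..<Suc (length (xs @ [x]))] = [1..<Suc (length xs)] @ [length xs + 1]"
    by simp
  then show ?thesis by (simp add: list_labeling_def del: upt_Suc)
qed

lemma list_labeling_single: "list_labeling [x] = [x \<mapsto> 1]"
  by (simp add: list_labeling_def)

lemma dom_list_labeling [simp]: "dom (list_labeling xs) = set xs"
proof -
  have "map fst (zip xs [1..<Suc (length xs)]) = xs"
    by (rule map_fst_zip) (simp del: upt_Suc)
  then have "fst ` set (zip xs [1..<Suc (length xs)]) = set xs"
    by (metis set_map)
  then show ?thesis
    by (simp add: list_labeling_def dom_map_of_conv_image_fst del: upt_Suc)
qed

lemma list_labeling_eq_Some_iff:
  assumes "distinct xs"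
  shows "list_labeling xs x = Some n \<longleftrightarrow> (\<exists>i<length xs. xs ! i = x \<and> n = i + 1)"
  using assms
proof (induction xs rule: rev_induct)
  case (snoc y xs)
  then show ?case
    by (auto simp: list_labeling_snoc nth_append less_Suc_eq)
qed (simp add: list_labeling_def)

lemma inj_on_list_labeling: "inj_on list_labeling {xs. distinct xs}"
proof (rule inj_onI, clarify)
  fix xs ys :: "'a list"
  assume d: "distinct xs" "distinct ys" and eq: "list_labeling xs = list_labeling ys"
  then have "set xs = set ys" by (metis dom_list_labeling)
  with d have len: "length xs = length ys" by (metis distinct_card)
  show "xs = ys"
  proof (rule nth_equalityI[OF len])
    fix i assume "i < length xs"
    then have "list_labeling xs (xs ! i) = Some (i + 1)"
      using d by (auto simp: list_labeling_eq_Some_iff)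
    with d eq show "xs ! i = ys ! i" by (auto simp: list_labeling_eq_Some_iff)
  qed
qed

section \<open>From walks to growth orders and back\<close>

lemma rw_state_imp_list:
  assumes "pair_wf_digraph G" and "rw_state G v i L"
  shows "\<exists>r xs. distinct (r # xs) \<and> grows (parcs G) {r} xs \<and> set (r # xs) \<subseteq> pverts G
    \<and> v \<in> set (r # xs) \<and> i = length (r # xs) \<and> L = list_labeling (r # xs)"
  using assms(2)
proof (induction rule: rw_state.induct)
  case (start v)
  then show ?case
    by (intro exI[of _ v] exI[of _ "[]"]) (simp add: list_labeling_single)
next
  case (step_labeled v i L w)
  then obtain r xs where rx: "distinct (r # xs)" "grows (parcs G) {r} xs"
    "set (r # xs) \<subseteq> pverts G" "i = length (r # xs)" "L = list_labeling (r # xs)" by blast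
  moreover have "w \<in> set (r # xs)"
    using step_labeled.hyps domIff[of w L] rx(5) by simp
  ultimately show ?case by blast
next
  case (step_unlabeled v i L w)
  then obtain r xs where rx: "distinct (r # xs)" "grows (parcs G) {r} xs"
    "set (r # xs) \<subseteq> pverts G" "v \<in> set (r # xs)" "i = length (r # xs)"
    "L = list_labeling (r # xs)" by blast
  have "w \<in> pverts G"
    using pair_wf_digraph.in_arcsD2[OF assms(1)] step_unlabeled by auto
  moreover have "w \<notin> set (r # xs)"
    using step_unlabeled.hyps domIff[of w L] rx(6) by simp
  \<comment> \<open>The visited neighbour of \<open>w\<close> is the current vertex
    \<open>v\<close>; this is why the claim also records that \<open>v\<close> is in the
    list.\<close>
  moreover have "grows (parcs G) {r} (xs @ [w])"
    using rx step_unlabeled.hyps by (auto simp: grows_append)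
  moreover have "L(w \<mapsto> i + 1) = list_labeling (r # xs @ [w])"
    using rx list_labeling_snoc[of "r # xs" w] by simp
  ultimately show ?case
    using rx by (intro exI[of _ r] exI[of _ "xs @ [w]"]) auto
qed

text \<open>Steps among labeled vertices change only the position. An unlabeled vertex must remain,
  since otherwise the process has stopped.\<close>

lemma rw_state_move:
  assumes "(v, w) \<in> (parcs G \<inter> dom L \<times> dom L)\<^sup>*" and "rw_state G v i L"
    and "\<exists>u\<in>pverts G. L u = None"
  shows "rw_state G w i L"
  using assms(1)
proof (induction rule: rtrancl_induct)
  case (step y z)
  then show ?case using assms(3) by (intro rw_state.step_labeled[of G y i L z]) auto
qed (fact assms(2))

text \<open>Each new vertex is attached to an earlier one, and old paths survive as the visited set
  grows. Keeping the paths inside that set is what lets \<open>rw_state_move\<close> follow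
  them.\<close>

lemma grows_connected:
  assumes "sym E" and "grows E {r} xs" and "u \<in> set (r # xs)"
  shows "(r, u) \<in> (E \<inter> set (r # xs) \<times> set (r # xs))\<^sup>*"
  using assms(2,3)
proof (induction xs arbitrary: u rule: rev_induct)
  case (snoc x xs)
  let ?R = "\<lambda>A. E \<inter> A \<times> A"
  have mono: "(?R (set (r # xs)))\<^sup>* \<subseteq> (?R (set (r # xs @ [x])))\<^sup>*"
    by (rule rtrancl_mono) auto
  have old: "(r, u) \<in> (?R (set (r # xs @ [x])))\<^sup>*" if "u \<in> set (r # xs)" for u
    using snoc.IH[of u] snoc.prems(1) that mono by (auto simp: grows_append)
  from snoc.prems(1) obtain y where "y \<in> set (r # xs)" "(y, x) \<in> E"
    by (auto simp: grows_append)
  then have "(r, x) \<in> (?R (set (r # xs @ [x])))\<^sup>*"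
    by (intro rtrancl_into_rtrancl[OF old[of y]]) auto
  moreover have "u \<in> set (r # xs) \<or> u = x" using snoc.prems(2) by auto
  ultimately show ?case using old by metis
qed simp

lemma list_imp_rw_state:
  assumes "sym (parcs G)" and "distinct (r # xs)" and "set (r # xs) \<subseteq> pverts G"
    and "grows (parcs G) {r} xs"
  shows "\<exists>v\<in>set (r # xs). rw_state G v (length (r # xs)) (list_labeling (r # xs))"
  using assms(2-)
proof (induction xs rule: rev_induct)
  case Nil
  then show ?case using rw_state.start[of r G] by (simp add: list_labeling_single del: fun_upd_apply)
next
  case (snoc x xs)
  let ?L = "list_labeling (r # xs)" and ?i = "length (r # xs)"
  let ?R = "parcs G \<inter> dom ?L \<times> dom ?L"
  have "grows (parcs G) {r} xs" "distinct (r # xs)" "set (r # xs) \<subseteq> pverts G"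
    using snoc.prems by (auto simp: grows_append)
  then obtain v where v: "v \<in> set (r # xs)" "rw_state G v ?i ?L"
    using snoc.IH by blast
  from snoc.prems obtain y where y: "y \<in> set (r # xs)" "(y, x) \<in> parcs G"
    by (auto simp: grows_append)
  have con: "(r, u) \<in> ?R\<^sup>*" if "u \<in> set (r # xs)" for u
    using grows_connected[OF assms(1) _ that] snoc.prems by (simp add: grows_append)
  have "sym ?R" using assms(1) by (auto simp: sym_def)
  \<comment> \<open>Walk back to the first vertex \<open>r\<close> by symmetry, then out to the
    neighbour \<open>y\<close> from which \<open>x\<close> is entered.\<close>
  then have "(v, y) \<in> ?R\<^sup>*"
    using con[OF v(1)] con[OF y(1)] by (meson rtrancl_trans sym_rtrancl symD)
  moreover have x: "x \<in> pverts G" "?L x = None"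
    using snoc.prems domIff[of x ?L] by auto
  ultimately have "rw_state G y ?i ?L" by (intro rw_state_move[OF _ v(2)]) auto
  with x y(2) have "rw_state G x (?i + 1) (?L(x \<mapsto> ?i + 1))"
    by (intro rw_state.step_unlabeled) auto
  then have "rw_state G x (length (r # xs @ [x])) (list_labeling (r # xs @ [x]))"
    using list_labeling_snoc[of "r # xs" x] by (simp del: fun_upd_apply)
  then show ?case by (intro bexI[of _ x]) auto
qed

lemma random_walk_labelings_eq:
  assumes "pair_wf_digraph G" and "sym (parcs G)" and "pverts G \<noteq> {}"
  shows "random_walk_labelings G =
    list_labeling ` (\<Union>r\<in>pverts G. (#) r ` growth_orders (parcs G) {r} (pverts G - {r}))"
    (is "?L = ?R")
proof
  show "?L \<subseteq> ?R"
  proof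
    fix L assume "L \<in> ?L"
    then obtain v i where st: "rw_state G v i L" and all: "\<forall>u\<in>pverts G. L u \<noteq> None"
      by (auto simp: random_walk_labelings_def)
    from rw_state_imp_list[OF assms(1) st] obtain r xs where rx: "distinct (r # xs)"
      "grows (parcs G) {r} xs" "set (r # xs) \<subseteq> pverts G" "L = list_labeling (r # xs)" by blast
    have "pverts G \<subseteq> dom L" using all by blast
    then have "pverts G = set (r # xs)" using rx by auto
    then have "r \<in> pverts G" "xs \<in> growth_orders (parcs G) {r} (pverts G - {r})"
      using rx(1,2) by (auto simp: growth_orders_def)
    then show "L \<in> ?R" unfolding rx(4) by blast
  qed
  show "?R \<subseteq> ?L"
  proof
    fix L assume "L \<in> ?R"
    then obtain r xs where rx: "r \<in> pverts G" "xs \<in> growth_orders (parcs G) {r} (pverts G - {r})"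
      and L: "L = list_labeling (r # xs)" by auto
    then have s: "set (r # xs) = pverts G" by (auto simp: growth_orders_def)
    obtain v where "rw_state G v (length (r # xs)) L"
      using list_imp_rw_state[OF assms(2), of r xs] rx s L by (auto simp: growth_orders_def)
    moreover have "\<forall>u\<in>pverts G. L u \<noteq> None"
      using s dom_list_labeling[of "r # xs"] domIff[of _ L] unfolding L by blast
    ultimately show "L \<in> ?L" by (auto simp: random_walk_labelings_def)
  qed
qed

lemma num_random_walk_labelings_eq:
  assumes "pair_wf_digraph G" and "sym (parcs G)" and "finite (pverts G)" and "pverts G \<noteq> {}"
  shows "num_random_walk_labelings G =
    (\<Sum>r\<in>pverts G. card (growth_orders (parcs G) {r} (pverts G - {r})))"
proof -
  let ?O = "\<lambda>r. growth_orders (parcs G) {r} (pverts G - {r})"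
  have fin: "finite ((#) r ` ?O r)" for r
    by (simp add: finite_growth_orders)
  have disj: "(#) r ` ?O r \<inter> (#) s ` ?O s = {}" if "r \<noteq> s" for r s
    using that by blast
  have "r \<notin> set xs \<and> distinct xs" if "xs \<in> ?O r" for r xs
    using that by (simp add: growth_orders_def)
  then have "(\<Union>r\<in>pverts G. (#) r ` ?O r) \<subseteq> {xs. distinct xs}" by force
  then have "inj_on list_labeling (\<Union>r\<in>pverts G. (#) r ` ?O r)"
    by (rule inj_on_subset[OF inj_on_list_labeling])
  then have "num_random_walk_labelings G = card (\<Union>r\<in>pverts G. (#) r ` ?O r)"
    using random_walk_labelings_eq[OF assms(1,2,4)]
    by (simp only: num_random_walk_labelings_def card_image)
  also have "\<dots> = (\<Sum>r\<in>pverts G. card ((#) r ` ?O r))"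
    using assms(3) fin disj by (intro card_UN_disjoint) blast+
  finally show ?thesis by (simp add: card_image)
qed


section \<open>Geometric sums in the coefficients\<close>

text \<open>\<open>\<Sum>i<k. m ^ i\<close> is the number of vertices of a perfect tree with
  \<open>k\<close> levels; every quotient in the coefficients is turned into such sizes.\<close>

lemma sum_powers_mult: "1 + (m - 1) * (\<Sum>i<k. m ^ i) = m ^ k" if "m \<ge> 1" for m k :: nat
proof (induction k)
  case (Suc k)
  have "1 + (m - 1) * (\<Sum>i<Suc k. m ^ i) = m ^ k + (m - 1) * m ^ k"
    using Suc by (simp add: algebra_simps)
  also have "\<dots> = (1 + (m - 1)) * m ^ k" by (simp only: distrib_right mult_1)
  finally show ?case using that by simp
qed simp

text \<open>For \<open>a < b\<close> both differences truncate to 0, so the identity covers that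
  case as well.\<close>

lemma diff_powers_div:
  fixes m a b :: nat
  assumes "m \<ge> 2"
  shows "(m ^ a - m ^ b) div (m - 1) = (\<Sum>i<a. m ^ i) - (\<Sum>i<b. m ^ i)"
proof -
  have "m ^ a - m ^ b = (m - 1) * ((\<Sum>i<a. m ^ i) - (\<Sum>i<b. m ^ i))"
    using sum_powers_mult[of m a] sum_powers_mult[of m b] assms
    by (simp add: diff_mult_distrib2)
  then show ?thesis using assms by simp
qed

lemma sum_powers_Suc: "(\<Sum>i<Suc k. m ^ i) = 1 + m * (\<Sum>i<k. m ^ i)" for m :: nat
  by (subst sum.lessThan_Suc_shift) (simp add: sum_distrib_left)

lemma rw_alpha_eq:
  assumes "m \<ge> 2"
  shows "rw_alpha j m =
    multinomial (sum_list (replicate m (\<Sum>i<j. m ^ i))) (replicate m (\<Sum>i<j. m ^ i))"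
proof -
  have "(m ^ (j + 1) - m) div (m - 1) = m * (\<Sum>i<j. m ^ i)"
    using diff_powers_div[OF assms, of "j + 1" 1] sum_powers_Suc[of m j] by simp
  moreover have "(m ^ j - 1) div (m - 1) = (\<Sum>i<j. m ^ i)"
    using diff_powers_div[OF assms, of j 0] by simp
  ultimately show ?thesis by (simp add: rw_alpha_def sum_list_replicate)
qed

text \<open>The entries are sizes met when moving up from depth \<open>k + 1\<close> to depth
  \<open>k\<close>: the \<open>m - 1\<close> sibling branches, then everything outside the branch at
  depth \<open>k\<close>. The \<open>- 1\<close> in \<open>rw_beta\<close> removes the ancestor
  itself.\<close>

lemma rw_beta_eq:
  assumes "m \<ge> 2" and "k \<le> h"
  shows "rw_beta h m k =
    (let ns = replicate (m - 1) (\<Sum>i<h - k. m ^ i) @ [(\<Sum>i<h + 1. m ^ i) - (\<Sum>i<h - k + 1. m ^ i)]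
     in multinomial (sum_list ns) ns)"
proof -
  let ?g = "\<lambda>n. \<Sum>i<n. m ^ i"
  have "?g (h - k + 1) \<le> ?g (h + 1)"
    by (rule sum_mono2) (use assms in auto)
  \<comment> \<open>A branch at depth \<open>k\<close> is its top, the child branch already left,
    and the \<open>m - 1\<close> others.\<close>
  moreover have "?g (h - k + 1) = 1 + (?g (h - k) + (m - 1) * ?g (h - k))"
    using assms sum_powers_Suc[of m "h - k"] by (cases m) auto
  ultimately have "?g (h + 1) - ?g (h - k) - 1 =
      (m - 1) * ?g (h - k) + (?g (h + 1) - ?g (h - k + 1))"
    by linarith
  moreover have "(m ^ (h - k) - 1) div (m - 1) = ?g (h - k)"
    using diff_powers_div[OF assms(1), of "h - k" 0] by simp
  ultimately show ?thesis
    by (simp only: rw_beta_def diff_powers_div[OF assms(1)] Let_def sum_list_append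
        sum_list_replicate sum_list.Cons sum_list.Nil add_0_right of_nat_id)
qed

lemma rw_gamma_eq:
  assumes "m \<ge> 2"
  shows "rw_gamma h m k =
    (((\<Sum>i<h + 1. m ^ i) - 1) choose ((\<Sum>i<h + 1 - k. m ^ i) - 1))"
  using diff_powers_div[OF assms, of "h + 1" 1] diff_powers_div[OF assms, of "h + 1 - k" 1]
  by (simp add: rw_gamma_def)

text \<open>Counts the orders of a perfect tree of height \<open>d\<close> that grow from its root:
  \<open>m ^ (d - j)\<close> vertices have a subtree of height \<open>j\<close>, and each
  contributes one shuffle of its child subtrees.\<close>

definition heap_orders :: "nat \<Rightarrow> nat \<Rightarrow> nat" where
  "heap_orders m d = (\<Prod>j = 1..d. rw_alpha j m ^ (m ^ (d - j)))"

lemma heap_orders_Suc: "heap_orders m (Suc d) = rw_alpha (Suc d) m * heap_orders m d ^ m"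
proof -
  have "rw_alpha j m ^ (m ^ (Suc d - j)) = (rw_alpha j m ^ (m ^ (d - j))) ^ m"
    if "j \<in> {1..d}" for j
    using that by (simp add: Suc_diff_le mult.commute flip: power_mult)
  then have "(\<Prod>j = 1..d. rw_alpha j m ^ (m ^ (Suc d - j))) = heap_orders m d ^ m"
    unfolding heap_orders_def prod_power_distrib by (intro prod.cong) auto
  then show ?thesis by (simp add: heap_orders_def mult.commute)
qed


section \<open>Growth orders in the perfect tree\<close>

context
  fixes h m :: nat
begin

abbreviation "V \<equiv> pverts (perfect_tree h m)"
abbreviation "E \<equiv> parcs (perfect_tree h m)"

text \<open>Lists run from a vertex up to the root, so ancestors are suffixes and this is the
  subtree rooted at \<open>p\<close>.\<close>

definition branch :: "nat list \<Rightarrow> nat list set" where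
  "branch p = {q \<in> V. suffix p q}"

lemma vertex_iff: "p \<in> V \<longleftrightarrow> length p \<le> h \<and> set p \<subseteq> {..<m}"
  by (simp add: perfect_tree_def)

lemma arc_iff: "(p, q) \<in> E \<longleftrightarrow> p \<in> V \<and> q \<in> V \<and> (\<exists>c. q = c # p \<or> p = c # q)"
  by (simp add: perfect_tree_def)

lemma vertex_ConsD: "c # q \<in> V \<Longrightarrow> q \<in> V"
  by (simp add: vertex_iff)

lemma finite_V: "finite V"
proof -
  interpret pair_graph "perfect_tree h m" by (rule pair_graph_perfect_tree)
  show ?thesis by simp
qed

lemma finite_branch: "finite (branch p)"
  using finite_V by (simp add: branch_def)

text \<open>An arc adds or drops the head of a list; adding keeps the suffix \<open>p\<close>, and
  dropping loses it only at \<open>p\<close> itself.\<close>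

lemma arc_leaving_branch:
  assumes "(u, v) \<in> E \<or> (v, u) \<in> E" and "suffix p u" and "\<not> suffix p v"
  shows "u = p \<and> (\<exists>c. p = c # v)"
  using assms by (auto simp: arc_iff suffix_Cons)

lemma suffix_siblings: "suffix (c # q) x \<Longrightarrow> suffix (d # q) x \<Longrightarrow> c = d"
  by (metis list.inject suffix_length_suffix suffix_order.antisym length_Cons order_refl)

lemma not_suffix_Cons_self [simp]: "\<not> suffix (c # q) q"
  by (auto dest: suffix_length_le)

text \<open>A branch is left only towards the parent \<open>q\<close> of its top, and
  \<open>q\<close> lies in neither sibling branch.\<close>

lemma separated_siblings:
  assumes "c \<noteq> d"
  shows "separated E (branch (c # q)) (branch (d # q))"
proof (rule separatedI)
  have excl: "\<not> suffix (c # q) v" if "v \<in> branch (d # q)" for v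
    using that suffix_siblings[of c q v d] assms by (auto simp: branch_def)
  show "branch (c # q) \<inter> branch (d # q) = {}"
    using excl by (auto simp: branch_def)
  fix u v assume u: "u \<in> branch (c # q)" and v: "v \<in> branch (d # q)"
  have "v \<noteq> q"
    using v by (auto simp: branch_def)
  then show "(u, v) \<notin> E \<and> (v, u) \<notin> E"
    using arc_leaving_branch[of u v "c # q"] u excl[OF v] by (auto simp: branch_def)
qed

text \<open>The only exit from the child branch is \<open>q\<close>, which is part of
  \<open>branch q\<close>.\<close>

lemma separated_outside:
  "separated E (branch (c # q)) (V - branch q)"
proof (rule separatedI)
  show "branch (c # q) \<inter> (V - branch q) = {}"
    by (auto simp: branch_def dest: suffix_ConsD)
  fix u v assume u: "u \<in> branch (c # q)" and v: "v \<in> V - branch q"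
  have "\<not> suffix (c # q) v" "v \<noteq> q"
    using v by (auto simp: branch_def dest: suffix_ConsD)
  then show "(u, v) \<notin> E \<and> (v, u) \<notin> E"
    using arc_leaving_branch[of u v "c # q"] u by (auto simp: branch_def)
qed

lemma separated_below_outside: "separated E (branch p - {p}) (V - branch p)"
proof (rule separatedI)
  fix u v assume "u \<in> branch p - {p}" and "v \<in> V - branch p"
  then show "(u, v) \<notin> E \<and> (v, u) \<notin> E"
    using arc_leaving_branch[of u v p] by (auto simp: branch_def)
qed auto

lemma sorted_wrt_separated_siblings:
  "distinct cs \<Longrightarrow> sorted_wrt (separated E) (map (\<lambda>c. branch (c # q)) cs)"
  by (induction cs) (auto intro!: separated_siblings)

section \<open>Sizes of branches\<close>

lemma card_branch:
  assumes "p \<in> V"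
  shows "card (branch p) = (\<Sum>i<h + 1 - length p. m ^ i)"
proof -
  \<comment> \<open>A vertex of the branch is \<open>p\<close> preceded by an arbitrary word no
    longer than the remaining height.\<close>
  have "branch p = (\<lambda>s. s @ p) ` {s. set s \<subseteq> {..<m} \<and> length s \<le> h - length p}"
    using assms by (auto simp: branch_def vertex_iff suffix_def)
  then have "card (branch p) = (\<Sum>i\<le>h - length p. m ^ i)"
    by (simp add: card_image card_lists_length_le inj_on_def)
  also have "{..h - length p} = {..<h + 1 - length p}"
    using assms by (auto simp: vertex_iff)
  finally show ?thesis .
qed

lemma card_V: "card V = (\<Sum>i<h + 1. m ^ i)"
proof -
  have "branch [] = V" by (simp add: branch_def)
  moreover have "[] \<in> V" by (simp add: vertex_iff)
  ultimately show ?thesis using card_branch[of "[]"] by simp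
qed

section \<open>Counting orders below and outside a vertex\<close>

lemma card_growth_orders_child:
  assumes "c # q \<in> V"
  shows "card (growth_orders E {q} (branch (c # q))) =
    card (growth_orders E {c # q} (branch (c # q) - {c # q}))"
proof (rule card_growth_orders_unique_start)
  fix u y assume "u \<in> {q}" "y \<in> branch (c # q)"
  then show "(u, y) \<in> E \<longleftrightarrow> u = q \<and> y = c # q"
    using arc_leaving_branch[of y q "c # q"] assms vertex_ConsD[OF assms]
    by (auto simp: branch_def arc_iff[of q "c # q"])
qed (use assms in \<open>auto simp: branch_def\<close>)

text \<open>Outside its own branch, \<open>c # q\<close> has only its parent as a neighbour, so
  \<open>q\<close> is forced first and the count restarts there.\<close>

lemma card_growth_orders_parent:
  assumes "c # q \<in> V"
  shows "card (growth_orders E {c # q} (V - branch (c # q))) =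
    card (growth_orders E {q} (V - branch (c # q) - {q}))"
proof (rule card_growth_orders_unique_start)
  fix u y assume "u \<in> {c # q}" "y \<in> V - branch (c # q)"
  then show "(u, y) \<in> E \<longleftrightarrow> u = c # q \<and> y = q"
    using arc_leaving_branch[of "c # q" y "c # q"] assms vertex_ConsD[OF assms]
    by (auto simp: branch_def arc_iff[of "c # q" q])
qed (use assms vertex_ConsD[OF assms] in \<open>auto simp: branch_def\<close>)

lemma branch_minus_top:
  "branch p - {p} = (\<Union>c<m. branch (c # p))"
proof -
  have "\<exists>c<m. suffix (c # p) x" if "x \<in> V" "suffix p x" "x \<noteq> p" for x
  proof -
    from that(2) obtain s where s: "x = s @ p" by (auto simp: suffix_def)
    with that(3) obtain s' c where "s = s' @ [c]" by (cases s rule: rev_cases) auto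
    with s that(1) show ?thesis by (auto simp: vertex_iff suffix_def)
  qed
  moreover have "x \<noteq> p" if "suffix (c # p) x" for c x
    using that by auto
  ultimately show ?thesis
    unfolding branch_def by (blast dest: suffix_ConsD)
qed

text \<open>Induction on the height \<open>d\<close> of the branch: the \<open>m\<close> child
  branches are shuffled freely, and each can be entered only at its own top, where the induction
  hypothesis applies.\<close>

lemma card_growth_orders_below:
  assumes "m \<ge> 2" and "p \<in> V" and "length p + d = h"
  shows "card (growth_orders E {p} (branch p - {p})) = heap_orders m d"
  using assms(2,3)
proof (induction d arbitrary: p)
  case 0
  then have empty: "branch p - {p} = {}"
    by (auto simp: branch_def vertex_iff suffix_def)
  show ?case unfolding empty by (simp add: heap_orders_def)
next
  case (Suc d)
  let ?Bs = "map (\<lambda>c. branch (c # p)) [0..<m]"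
  have child: "c # p \<in> V" if "c < m" for c
    using that Suc.prems by (auto simp: vertex_iff)
  have "map card ?Bs = map (\<lambda>c. \<Sum>i<Suc d. m ^ i) [0..<m]"
    using card_branch child Suc.prems(2) by (auto simp flip: Suc.prems(2))
  then have cards: "map card ?Bs = replicate m (\<Sum>i<Suc d. m ^ i)"
    by (simp add: map_replicate_const)
  have "map (\<lambda>B. card (growth_orders E {p} B)) ?Bs = map (\<lambda>c. heap_orders m d) [0..<m]"
    using card_growth_orders_child child Suc.IH Suc.prems(2) by auto
  then have orders: "map (\<lambda>B. card (growth_orders E {p} B)) ?Bs = replicate m (heap_orders m d)"
    by (simp add: map_replicate_const)
  have union: "branch p - {p} = \<Union> (set ?Bs)"
    by (simp add: branch_minus_top atLeast0LessThan)
  have "card (growth_orders E {p} (\<Union> (set ?Bs))) =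
    multinomial (sum_list (map card ?Bs)) (map card ?Bs)
      * (\<Prod>B\<leftarrow>?Bs. card (growth_orders E {p} B))"
    using finite_branch
    by (intro card_growth_orders_Union[THEN conjunct1] sorted_wrt_separated_siblings) auto
  then show ?case
    unfolding union cards orders
    by (simp add: heap_orders_Suc rw_alpha_eq[OF assms(1)] prod_list_replicate del: sum.lessThan_Suc)
qed

lemma outside_branch_Cons:
  assumes "c # q \<in> V"
  shows "V - branch (c # q) - {q} =
    \<Union> (set (map (\<lambda>d. branch (d # q)) (remove1 c [0..<m]) @ [V - branch q]))" (is "?L = ?R")
proof -
  have sub: "branch (c # q) \<subseteq> branch q"
    by (auto simp: branch_def dest: suffix_ConsD)
  have q: "q \<in> branch q" "branch q \<subseteq> V"
    using vertex_ConsD[OF assms] by (auto simp: branch_def)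
  have "branch (d # q) \<inter> branch (c # q) = {}" if "d \<noteq> c" for d
    using separated_siblings[OF that] by (simp add: separated_def)
  then have "branch q - {q} - branch (c # q) = (\<Union>d\<in>{..<m} - {c}. branch (d # q))"
    unfolding branch_minus_top by blast
  moreover have "?L = (branch q - {q} - branch (c # q)) \<union> (V - branch q)"
    using sub q by blast
  moreover have "set (remove1 c [0..<m]) = {..<m} - {c}" by auto
  ultimately show ?thesis by (simp add: Un_commute)
qed

text \<open>After the forced move to \<open>q\<close>, the sibling branches, of height
  \<open>h - 1 - length q\<close>, are shuffled with the outside of \<open>branch q\<close>; the
  latter is the same problem one level up.\<close>

lemma card_growth_orders_outside_Cons:
  assumes "m \<ge> 2" and "c # q \<in> V"
  shows "card (growth_orders E {c # q} (V - branch (c # q))) =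
    rw_beta h m (length q) * heap_orders m (h - 1 - length q) ^ (m - 1)
      * card (growth_orders E {q} (V - branch q))"
proof -
  let ?cs = "remove1 c [0..<m]"
  let ?Bs = "map (\<lambda>d. branch (d # q)) ?cs @ [V - branch q]"
  note q = vertex_ConsD[OF assms(2)]
  have c: "c < m" and len: "length q < h" using assms(2) by (auto simp: vertex_iff)
  have len_cs: "length ?cs = m - 1" using c by (simp add: length_remove1)
  have child: "d # q \<in> V" if "d \<in> set ?cs" for d
    using that q len by (auto simp: vertex_iff)
  have "map (\<lambda>d. card (branch (d # q))) ?cs = map (\<lambda>d. \<Sum>i<h - length q. m ^ i) ?cs"
    using card_branch child by (intro map_cong) auto
  \<comment> \<open>If \<open>q\<close> is the root, this piece is empty and its entry is 0.\<close>
  moreover have "card (V - branch q) = (\<Sum>i<h + 1. m ^ i) - (\<Sum>i<h - length q + 1. m ^ i)"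
    using card_branch[OF q] card_V finite_branch len
    by (subst card_Diff_subset) (auto simp: branch_def Suc_diff_le)
  ultimately have cards: "map card ?Bs = replicate (m - 1) (\<Sum>i<h - length q. m ^ i)
      @ [(\<Sum>i<h + 1. m ^ i) - (\<Sum>i<h - length q + 1. m ^ i)]"
    by (simp add: map_replicate_const len_cs comp_def del: sum.lessThan_Suc)
  have "map (\<lambda>d. card (growth_orders E {q} (branch (d # q)))) ?cs =
      map (\<lambda>d. heap_orders m (h - 1 - length q)) ?cs"
    using card_growth_orders_child child card_growth_orders_below[OF assms(1)] len
    by (intro map_cong) auto
  then have orders: "(\<Prod>B\<leftarrow>?Bs. card (growth_orders E {q} B)) =
      heap_orders m (h - 1 - length q) ^ (m - 1) * card (growth_orders E {q} (V - branch q))"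
    by (simp add: map_replicate_const len_cs comp_def prod_list_replicate)
  have "sorted_wrt (separated E) ?Bs"
    using sorted_wrt_separated_siblings[of ?cs q] separated_outside[of _ q]
    by (auto simp: sorted_wrt_append)
  then have "card (growth_orders E {q} (\<Union> (set ?Bs))) =
    multinomial (sum_list (map card ?Bs)) (map card ?Bs)
      * (\<Prod>B\<leftarrow>?Bs. card (growth_orders E {q} B))"
    by (rule card_growth_orders_Union[THEN conjunct1]) (use finite_branch finite_V in auto)
  then show ?thesis
    unfolding card_growth_orders_parent[OF assms(2)] outside_branch_Cons[OF assms(2)] orders cards
    using rw_beta_eq[OF assms(1), of "length q" h] len by (simp add: Let_def mult.assoc)
qed

text \<open>Structural induction on \<open>p\<close> climbs to the root, outside whose branch
  nothing is left; moving up to depth \<open>j\<close> yields factor \<open>j\<close>.\<close>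

lemma card_growth_orders_outside:
  assumes "m \<ge> 2" and "p \<in> V"
  shows "card (growth_orders E {p} (V - branch p)) =
    (\<Prod>j<length p. rw_beta h m j * heap_orders m (h - 1 - j) ^ (m - 1))"
  using assms(2)
proof (induction p)
  case Nil
  have empty: "V - branch [] = {}" by (auto simp: branch_def)
  show ?case unfolding empty by simp
next
  case (Cons c q)
  then show ?case
    using card_growth_orders_outside_Cons[OF assms(1)] vertex_ConsD by (simp add: mult.commute)
qed

text \<open>Once \<open>p\<close> is visited, its proper descendants and the vertices outside its
  branch are separated; \<open>rw_gamma\<close> chooses the positions of the descendants among all
  vertices but \<open>p\<close>.\<close>

lemma card_growth_orders_from_vertex:
  assumes "m \<ge> 2" and "p \<in> V"
  shows "card (growth_orders E {p} (V - {p})) =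
    rw_gamma h m (length p) * heap_orders m (h - length p)
      * (\<Prod>j<length p. rw_beta h m j * heap_orders m (h - 1 - j) ^ (m - 1))"
proof -
  have p: "p \<in> branch p" "branch p \<subseteq> V" using assms(2) by (auto simp: branch_def)
  have below: "card (branch p - {p}) = (\<Sum>i<h + 1 - length p. m ^ i) - 1"
    using p finite_branch card_branch[OF assms(2)] by simp
  have "card (branch p - {p}) + card (V - branch p) = card (V - {p})"
    using p finite_V finite_branch
    by (subst card_Un_disjoint[symmetric]) (auto intro!: arg_cong[where f = card])
  then have total: "card (branch p - {p}) + card (V - branch p) = (\<Sum>i<h + 1. m ^ i) - 1"
    using finite_V assms(2) card_V by simp
  have "V - {p} = (branch p - {p}) \<union> (V - branch p)" using p by blast
  then have "card (growth_orders E {p} (V - {p})) = rw_gamma h m (length p)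
      * (card (growth_orders E {p} (branch p - {p})) * card (growth_orders E {p} (V - branch p)))"
    using card_growth_orders_Un[OF separated_below_outside, of "{p}" p]
    by (simp only: total rw_gamma_eq[OF assms(1)] flip: below)
  then show ?thesis
    using card_growth_orders_below[OF assms, of "h - length p"]
      card_growth_orders_outside[OF assms] assms(2)
    by (simp add: vertex_iff mult.assoc)
qed

section \<open>Summation over the first vertex\<close>

lemma sum_over_depths: "(\<Sum>p\<in>V. f (length p)) = (\<Sum>k = 0..h. m ^ k * f k)" for f :: "nat \<Rightarrow> nat"
proof -
  have "(\<Sum>p\<in>V. f (length p)) = (\<Sum>k = 0..h. \<Sum>p\<in>{p \<in> V. length p = k}. f (length p))"
    by (rule sum.group[symmetric]) (auto simp: finite_V vertex_iff)
  also have "\<dots> = (\<Sum>k = 0..h. m ^ k * f k)"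
  proof (rule sum.cong[OF refl])
    fix k assume "k \<in> {0..h}"
    then have "{p \<in> V. length p = k} = {p. set p \<subseteq> {..<m} \<and> length p = k}"
      by (auto simp: vertex_iff)
    then have "card {p \<in> V. length p = k} = m ^ k"
      by (simp add: card_lists_length_eq)
    then show "(\<Sum>p\<in>{p \<in> V. length p = k}. f (length p)) = m ^ k * f k" by simp
  qed
  finally show ?thesis .
qed

end

theorem theorem1:
  fixes m h :: nat
  assumes "m \<ge> 2"
  shows "num_random_walk_labelings (perfect_tree h m) =
    (\<Sum>k = 0..h. m ^ k * rw_gamma h m k
        * (\<Prod>j = 1..h - k. rw_alpha j m ^ (m ^ (h - k - j)))
        * (\<Prod>j \<in> {0..<k}. rw_beta h m j
             * (\<Prod>l = 1..h - 1 - j. rw_alpha l m ^ ((m - 1) * m ^ (h - 1 - j - l)))))"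
proof -
  interpret pair_graph "perfect_tree h m" by (rule pair_graph_perfect_tree)
  have pow: "heap_orders m d ^ (m - 1) = (\<Prod>l = 1..d. rw_alpha l m ^ ((m - 1) * m ^ (d - l)))" for d
    by (simp add: heap_orders_def prod_power_distrib mult.commute flip: power_mult)
  have "[] \<in> pverts (perfect_tree h m)" by (simp add: vertex_iff)
  then have "num_random_walk_labelings (perfect_tree h m) =
    (\<Sum>p\<in>V h m. card (growth_orders (E h m) {p} (V h m - {p})))"
    using sym_arcs by (intro num_random_walk_labelings_eq) (auto simp: symmetric_def pair_wf_digraph_axioms)
  also have "\<dots> = (\<Sum>p\<in>V h m. rw_gamma h m (length p) * heap_orders m (h - length p)
      * (\<Prod>j<length p. rw_beta h m j * heap_orders m (h - 1 - j) ^ (m - 1)))"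
    using card_growth_orders_from_vertex[OF assms] by (rule sum.cong[OF refl])
  \<comment> \<open>The count depends on \<open>p\<close> only through its depth, and
    \<open>m ^ k\<close> vertices have depth \<open>k\<close>.\<close>
  also have "\<dots> = (\<Sum>k = 0..h. m ^ k * (rw_gamma h m k * heap_orders m (h - k)
      * (\<Prod>j<k. rw_beta h m j * heap_orders m (h - 1 - j) ^ (m - 1))))"
    by (rule sum_over_depths)
  finally show ?thesis
    unfolding pow by (simp add: heap_orders_def mult.assoc atLeast0LessThan)
qed

end
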